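(* Let $\tilde\delta$ be an $n$-variate normally distributed random vector with mean $\mathbf{0}$ and invertible covariance matrix $\Sigma\in\mathbb{R}^{n\times n}$ with $\Sigma_{ii}=1$ for all $i\in[n]$. Let $E$ be the edge set of an undirected graph on $[n]$. Given $p\in(0,1)$, let $\gamma_{ij}=\sqrt{\chi^2_{1-p}(n)}\,\|\Sigma^{1/2}e_{ij}\|$ for all $i,j\in[n]$ such that $\{i,j\}\in E$ or $i=j$, where $\chi^2_{1-p}(n)$ is the $1-p$ quantile of the $\chi^2$ distribution with $n$ degrees of freedom. Then the set $$\mathcal{U}_{\mathcal S}=\{\delta\in\mathbb{R}^n : |\delta_i|\le\gamma_{ii}\ \forall i\in[n],\ |\delta_i-\delta_j|\le\gamma_{ij}\ \forall \{i,j\}\in E\}$$ satisfies $\mathbb{P}[\tilde\delta\in\mathcal{U}_{\mathcal S}]\ge 1-p$.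
   Context: $[n]=\{1,\dots,n\}$; $\|\cdot\|$ is the Euclidean norm; $\Sigma^{1/2}$ is the symmetric positive definite square root of $\Sigma$. With $e_i$ the standard unit vectors of $\mathbb{R}^n$, $e_{ij}=e_i-e_j$ if $i\ne j$ and $e_{ii}=e_i$. Edges of the graph join distinct vertices. *)

theory Defs
  imports "HOL-Probability.Probability"
begin

definition std_normal :: "real measure" where
  "std_normal = density lborel (\<lambda>x. ennreal (std_normal_density x))"

definition std_normal_vec :: "(real ^ 'n::finite) measure" where
  "std_normal_vec = distr (\<Pi>\<^sub>M i\<in>(UNIV::'n set). std_normal) borel (\<lambda>z. \<chi> i. z i)"

text \<open>
  A random vector is normally distributed if it has the law of an affine image of a standard
  normal vector. The equality is between laws, so the underlying probability space need not
  carry a standard normal vector. The matrix may be singular, so degenerate normal vectors are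
  included. Square matrices yield every normal law on the space, since the normal law with mean
  \<open>\<mu>\<close> and covariance \<open>\<Sigma>\<close> is obtained for \<open>A\<close> a square root of \<open>\<Sigma>\<close>.
\<close>

definition normal_vector :: "'a measure \<Rightarrow> ('a \<Rightarrow> real ^ 'n::finite) \<Rightarrow> bool" where
  "normal_vector M X \<longleftrightarrow>
     X \<in> borel_measurable M \<and>
     (\<exists>(\<mu> :: real ^ 'n) (A :: real ^ 'n ^ 'n).
        distr M borel X = distr std_normal_vec borel (\<lambda>z. \<mu> + A *v z))"

definition mean_vector :: "'a measure \<Rightarrow> ('a \<Rightarrow> real ^ 'n::finite) \<Rightarrow> real ^ 'n" where
  "mean_vector M X = (\<chi> i. \<integral>\<omega>. X \<omega> $ i \<partial>M)"

definition covariance_matrix :: "'a measure \<Rightarrow> ('a \<Rightarrow> real ^ 'n::finite) \<Rightarrow> real ^ 'n ^ 'n" where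
  "covariance_matrix M X =
     (\<chi> i j. \<integral>\<omega>. (X \<omega> $ i - mean_vector M X $ i) * (X \<omega> $ j - mean_vector M X $ j) \<partial>M)"

definition chi_squared :: "nat \<Rightarrow> real measure" where
  "chi_squared n = distr (\<Pi>\<^sub>M i\<in>{..<n}. std_normal) borel (\<lambda>z. \<Sum>i<n. (z i)\<^sup>2)"

definition quantile :: "real measure \<Rightarrow> real \<Rightarrow> real" where
  "quantile M u = Inf {x. u \<le> cdf M x}"

definition sym_pos_def :: "real ^ 'n::finite ^ 'n \<Rightarrow> bool" where
  "sym_pos_def A \<longleftrightarrow> transpose A = A \<and> (\<forall>x. x \<noteq> 0 \<longrightarrow> 0 < x \<bullet> (A *v x))"

definition matrix_sqrt :: "real ^ 'n::finite ^ 'n \<Rightarrow> real ^ 'n ^ 'n" where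
  "matrix_sqrt \<Sigma> = (THE R. sym_pos_def R \<and> R ** R = \<Sigma>)"

definition diff_vec :: "'n::finite \<Rightarrow> 'n \<Rightarrow> real ^ 'n" where
  "diff_vec i j = (if i = j then axis i 1 else axis i 1 - axis j 1)"

definition uncertainty_set ::
  "'n::finite set set \<Rightarrow> ('n \<Rightarrow> 'n \<Rightarrow> real) \<Rightarrow> (real ^ 'n) set" where
  "uncertainty_set E \<gamma> =
     {\<delta>. (\<forall>i. \<bar>\<delta> $ i\<bar> \<le> \<gamma> i i) \<and> (\<forall>i j. {i, j} \<in> E \<longrightarrow> \<bar>\<delta> $ i - \<delta> $ j\<bar> \<le> \<gamma> i j)}"

end

theory Submission
  imports Defs
begin

text \<open>
  The vector has the law of \<open>A *v z\<close>, where \<open>z\<close> is standard normal and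
  \<open>A ** transpose A = \<Sigma>\<close>. The set \<open>{z. z \<bullet> z \<le> q}\<close>, with \<open>q\<close> the quantile of the
  chi-squared law, has probability at least \<open>1 - p\<close>, because the squared length of \<open>z\<close> is
  chi-squared distributed and a distribution function is right continuous. For any direction
  \<open>v\<close>, the Cauchy-Schwarz inequality gives
  \<open>\<bar>v \<bullet> (A *v z)\<bar> \<le> norm (transpose A *v v) * norm z\<close>, and the first factor is the norm of
  \<open>matrix_sqrt \<Sigma> *v v\<close>, since the squares of both are \<open>v \<bullet> (\<Sigma> *v v)\<close>. Hence the map
  \<open>A\<close> sends that ball into every slab that bounds the uncertainty set: the confidence ellipsoid
  lies in the set, whose slabs are those in the directions \<open>diff_vec i j\<close>.

  Two facts carry the argument. The first is that \<open>matrix_sqrt \<Sigma>\<close>, a definite description, does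
  denote a root of \<open>\<Sigma>\<close> (\<open>matrix_sqrt_sym_pos_def\<close>). Existence is variational and avoids
  the spectral theorem: among all \<open>B\<close> with \<open>B ** transpose B = \<Sigma>\<close>, a compact set stable
  under right multiplication by reflections, one of maximal trace is symmetric and positive
  definite, the factor in the polar decomposition of \<open>A\<close>. Uniqueness is a trace identity. The second
  fact is that the mean and the covariance of an affine image of a standard normal vector
  determine the shift and \<open>A ** transpose A\<close> (\<open>normal_vector_mean_and_covariance\<close>).
\<close>

section \<open>Reflections and the trace\<close>

lemma inner_matrix_vector_transpose:
  fixes A :: "real ^ 'n ^ 'm"
  shows "x \<bullet> (A *v y) = (transpose A *v x) \<bullet> y"
  by (simp add: dot_lmul_matrix)

lemma linear_coeff_zero_of_nonneg_quadratic:
  fixes a b :: real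
  assumes "\<And>t. 0 \<le> t * b + t\<^sup>2 * a"
  shows "b = 0"
proof (rule ccontr)
  assume "b \<noteq> 0"
  \<comment> \<open>Any \<open>s > 0\<close> with \<open>s * a < 1\<close> makes the linear term dominate at \<open>t = - s * b\<close>.\<close>
  define s where "s = 1 / (\<bar>a\<bar> + 1)"
  have s: "0 < s" "s * a < 1"
    unfolding s_def by (auto simp: divide_simps)
  have "(- s * b) * b + (- s * b)\<^sup>2 * a = s * b\<^sup>2 * (s * a - 1)"
    by (simp add: power2_eq_square algebra_simps)
  also have "\<dots> < 0"
    using s \<open>b \<noteq> 0\<close> by (intro mult_pos_neg) auto
  finally show False
    using assms[of "- s * b"] by simp
qed

text \<open>
  The orthogonal reflection in the hyperplane perpendicular to \<open>u\<close>. Dividing by \<open>u \<bullet> u\<close>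
  allows vectors of any length; for \<open>u = 0\<close> the quotient vanishes and the matrix is the identity.
\<close>

definition reflection :: "real ^ 'n::finite \<Rightarrow> real ^ 'n ^ 'n" where
  "reflection u = (\<chi> i j. (if i = j then 1 else 0) - 2 * (u $ i * u $ j) / (u \<bullet> u))"

lemma transpose_reflection: "transpose (reflection u) = reflection u"
  by (simp add: reflection_def transpose_def vec_eq_iff mult.commute eq_commute)

lemma reflection_mult_vec: "reflection u *v x = x - (2 * (u \<bullet> x) / (u \<bullet> u)) *\<^sub>R u"
proof -
  have "(reflection u *v x) $ i = (x - (2 * (u \<bullet> x) / (u \<bullet> u)) *\<^sub>R u) $ i" for i
  proof -
    have "(reflection u *v x) $ i
        = (\<Sum>j\<in>UNIV. (if i = j then x $ j else 0)) - (\<Sum>j\<in>UNIV. 2 * u $ i / (u \<bullet> u) * (u $ j * x $ j))"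
      unfolding matrix_vector_mult_def reflection_def sum_subtractf[symmetric]
      by (auto intro!: sum.cong simp: algebra_simps)
    also have "\<dots> = x $ i - 2 * u $ i / (u \<bullet> u) * (u \<bullet> x)"
      by (simp add: inner_vec_def sum_distrib_left)
    finally show ?thesis by (simp add: algebra_simps)
  qed
  then show ?thesis by (simp add: vec_eq_iff)
qed

lemma reflection_involution:
  assumes "u \<noteq> 0"
  shows "reflection u ** reflection u = mat 1"
proof -
  have "reflection u *v (reflection u *v x) = x" for x
  proof -
    have "2 * (u \<bullet> (x - (2 * (u \<bullet> x) / (u \<bullet> u)) *\<^sub>R u)) / (u \<bullet> u) = - (2 * (u \<bullet> x) / (u \<bullet> u))"
      using assms by (simp add: inner_diff_right)
    then show ?thesis
      by (simp only: reflection_mult_vec) simp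
  qed
  then show ?thesis
    by (simp add: matrix_eq flip: matrix_vector_mul_assoc)
qed

lemma trace_mult_reflection:
  "trace (B ** reflection u) = trace B - 2 * (u \<bullet> (B *v u)) / (u \<bullet> u)"
proof -
  have "(B ** reflection u) $ i $ i = B $ i $ i - 2 / (u \<bullet> u) * (u $ i * (B *v u) $ i)" for i
  proof -
    have "(B ** reflection u) $ i $ i
        = (\<Sum>k\<in>UNIV. (if k = i then B $ i $ k else 0)) - (\<Sum>k\<in>UNIV. 2 / (u \<bullet> u) * u $ i * (B $ i $ k * u $ k))"
      unfolding matrix_matrix_mult_def reflection_def sum_subtractf[symmetric]
      by (auto intro!: sum.cong simp: algebra_simps)
    also have "\<dots> = B $ i $ i - 2 / (u \<bullet> u) * u $ i * (B *v u) $ i"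
      by (simp add: matrix_vector_mult_def sum_distrib_left)
    finally show ?thesis by (simp add: algebra_simps)
  qed
  then have "trace (B ** reflection u)
      = (\<Sum>i\<in>UNIV. B $ i $ i) - (\<Sum>i\<in>UNIV. 2 / (u \<bullet> u) * (u $ i * (B *v u) $ i))"
    unfolding trace_def by (simp add: sum_subtractf)
  also have "\<dots> = trace B - 2 / (u \<bullet> u) * (u \<bullet> (B *v u))"
    unfolding trace_def inner_vec_def by (simp add: sum_distrib_left)
  finally show ?thesis by simp
qed

section \<open>The positive definite square root\<close>

text \<open>
  The rows of \<open>B\<close> have prescribed inner products, which are closed conditions, and the
  diagonal ones fix the norm of \<open>B\<close>.
\<close>

lemma compact_gram_fibre:
  fixes S :: "real ^ 'n ^ 'n"
  shows "compact {B :: real ^ 'n ^ 'n. B ** transpose B = S}"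
proof -
  have entry: "(B ** transpose B) $ i $ j = B $ i \<bullet> B $ j" for B :: "real ^ 'n ^ 'n" and i j
    by (simp add: matrix_matrix_mult_def transpose_def inner_vec_def)
  have eq: "{B :: real ^ 'n ^ 'n. B ** transpose B = S} = (\<Inter>i. \<Inter>j. {B. B $ i \<bullet> B $ j = S $ i $ j})"
    by (simp add: set_eq_iff vec_eq_iff entry)
  have "closed {B :: real ^ 'n ^ 'n. B ** transpose B = S}"
    unfolding eq by (intro closed_INT ballI closed_Collect_eq continuous_intros)
  moreover have "norm B \<le> sqrt (trace S)" if "B ** transpose B = S" for B :: "real ^ 'n ^ 'n"
    using that by (simp add: norm_eq_sqrt_inner inner_vec_def[of B B] trace_def entry flip: that)
  then have "bounded {B :: real ^ 'n ^ 'n. B ** transpose B = S}"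
    by (auto simp: bounded_iff)
  ultimately show ?thesis
    by (simp add: compact_eq_bounded_closed)
qed

text \<open>
  A zero of a nonnegative form is a minimum of it, so the derivative \<open>2 * (R *v x)\<close> vanishes
  there. This upgrades a semidefinite root of an invertible matrix to a definite one.
\<close>

lemma nonneg_form_kernel:
  fixes R :: "real ^ 'n ^ 'n"
  assumes sym: "transpose R = R" and nonneg: "\<And>x. 0 \<le> x \<bullet> (R *v x)"
    and zero: "x \<bullet> (R *v x) = 0"
  shows "R *v x = 0"
proof -
  have "2 * (y \<bullet> (R *v x)) = 0" for y
  proof (rule linear_coeff_zero_of_nonneg_quadratic)
    fix t
    have "x \<bullet> (R *v y) = y \<bullet> (R *v x)"
      using inner_matrix_vector_transpose[of x R y] sym by (simp add: inner_commute)
    then have "(x + t *\<^sub>R y) \<bullet> (R *v (x + t *\<^sub>R y)) = t * (2 * (y \<bullet> (R *v x))) + t\<^sup>2 * (y \<bullet> (R *v y))"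
      using zero
      by (simp add: matrix_vector_right_distrib matrix_vector_mult_scaleR inner_add_left inner_add_right
          power2_eq_square algebra_simps)
    then show "0 \<le> t * (2 * (y \<bullet> (R *v x))) + t\<^sup>2 * (y \<bullet> (R *v y))"
      using nonneg by metis
  qed
  from this[of "R *v x"] show ?thesis by simp
qed

text \<open>
  Multiplying \<open>B\<close> by a reflection changes the trace by a negative multiple of the quadratic
  form of \<open>B\<close>, so maximality makes the form nonnegative. Multiplying by two reflections, that
  is, by a rotation, in the plane of two coordinates at an angle governed by \<open>t\<close> changes the
  trace to first order by the antisymmetric part of \<open>B\<close>, so maximality makes \<open>B\<close> symmetric.
\<close>

lemma trace_maximal_symmetric_nonneg:
  fixes B :: "real ^ 'n ^ 'n"
  assumes max: "\<And>C. C ** transpose C = B ** transpose B \<Longrightarrow> trace C \<le> trace B"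
  shows "transpose B = B" and "0 \<le> x \<bullet> (B *v x)"
proof -
  have orbit: "(C ** reflection u) ** transpose (C ** reflection u) = C ** transpose C"
    if "u \<noteq> 0" for C :: "real ^ 'n ^ 'n" and u
    by (metis matrix_mul_assoc matrix_mul_rid matrix_transpose_mul reflection_involution that
        transpose_reflection)
  show "0 \<le> x \<bullet> (B *v x)"
  proof (cases "x = 0")
    case False
    with max[OF orbit, of x] have "0 \<le> 2 * (x \<bullet> (B *v x)) / (x \<bullet> x)"
      by (simp add: trace_mult_reflection)
    moreover from False have "0 < x \<bullet> x"
      by simp
    ultimately show ?thesis
      by (simp add: zero_le_divide_iff)
  qed simp
  have "B $ i $ j = B $ j $ i" if "i \<noteq> j" for i j
  proof -
    have "B $ i $ j - B $ j $ i = 0"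
    proof (rule linear_coeff_zero_of_nonneg_quadratic)
      fix t :: real
      define u :: "real ^ 'n" where "u = axis i 1"
      define v :: "real ^ 'n" where "v = axis i 1 + t *\<^sub>R axis j 1"
      have uv: "u \<bullet> u = 1" "u \<bullet> v = 1" "v \<bullet> v = 1 + t\<^sup>2"
        using that
        by (simp_all add: u_def v_def inner_add_left inner_add_right inner_axis_axis power2_eq_square)
      have form: "axis k 1 \<bullet> (B *v axis l 1) = B $ k $ l" for k l
        by (simp add: inner_axis' matrix_vector_mul_component inner_axis)
      have Bu: "u \<bullet> (B *v u) = B $ i $ i" "v \<bullet> (B *v u) = B $ i $ i + t * B $ j $ i"
        "v \<bullet> (B *v v) = B $ i $ i + t * (B $ i $ j + B $ j $ i) + t\<^sup>2 * B $ j $ j"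
        by (simp_all add: u_def v_def inner_add_left inner_add_right matrix_vector_right_distrib
            matrix_vector_mult_scaleR form power2_eq_square algebra_simps)
      have pos: "0 < 1 + t\<^sup>2" by (simp add: add_pos_nonneg)
      have nz: "u \<noteq> 0" "v \<noteq> 0"
        using uv pos by auto
      \<comment> \<open>The rotation is a product of two reflections, in vectors at slope \<open>t\<close> to each other.\<close>
      have "trace (B ** reflection u ** reflection v) \<le> trace B"
        by (intro max) (simp add: orbit nz)
      moreover have "trace (B ** reflection u ** reflection v)
          = trace B - 2 * (u \<bullet> (B *v u)) - 2 * ((v \<bullet> (B *v v) - 2 * (v \<bullet> (B *v u))) / (1 + t\<^sup>2))"
        by (simp add: trace_mult_reflection uv matrix_vector_mul_assoc[symmetric] reflection_mult_vec
            matrix_vector_mult_diff_distrib matrix_vector_mult_scaleR inner_diff_right)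
      ultimately have "0 \<le> u \<bullet> (B *v u) + (v \<bullet> (B *v v) - 2 * (v \<bullet> (B *v u))) / (1 + t\<^sup>2)"
        by linarith
      then have "0 \<le> (u \<bullet> (B *v u)) * (1 + t\<^sup>2) + (v \<bullet> (B *v v) - 2 * (v \<bullet> (B *v u)))"
        using pos by (simp add: field_simps)
      then show "0 \<le> t * (B $ i $ j - B $ j $ i) + t\<^sup>2 * (B $ i $ i + B $ j $ j)"
        unfolding Bu by (simp add: algebra_simps)
    qed
    then show ?thesis by simp
  qed
  then show "transpose B = B"
    by (auto simp: transpose_def vec_eq_iff) metis
qed

lemma sym_pos_def_sqrt_exists:
  fixes A :: "real ^ 'n ^ 'n"
  assumes "invertible (A ** transpose A)"
  shows "\<exists>R. sym_pos_def R \<and> R ** R = A ** transpose A"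
proof -
  let ?F = "{B :: real ^ 'n ^ 'n. B ** transpose B = A ** transpose A}"
  have "continuous_on ?F trace"
    unfolding trace_def by (intro continuous_intros)
  then obtain B where B: "B \<in> ?F" and max: "\<And>C. C \<in> ?F \<Longrightarrow> trace C \<le> trace B"
    using continuous_attains_sup[OF compact_gram_fibre, of "A ** transpose A" trace] by blast
  have max': "trace C \<le> trace B" if "C ** transpose C = B ** transpose B" for C
    using max B that by simp
  have sym: "transpose B = B" and nonneg: "\<And>x. 0 \<le> x \<bullet> (B *v x)"
    using trace_maximal_symmetric_nonneg[OF max'] by blast+
  have sq: "B ** B = A ** transpose A"
    using B sym by simp
  have "0 < x \<bullet> (B *v x)" if "x \<noteq> 0" for x
  proof (rule ccontr)
    assume "\<not> 0 < x \<bullet> (B *v x)"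
    with nonneg[of x] have "B *v x = 0"
      by (intro nonneg_form_kernel sym nonneg) simp
    then have "(A ** transpose A) *v x = 0"
      by (simp flip: sq matrix_vector_mul_assoc)
    then show False
      using assms that by (metis invertible_def matrix_left_invertible_ker)
  qed
  with sym sq show ?thesis
    unfolding sym_pos_def_def by blast
qed

text \<open>
  With \<open>D = R - S\<close>, equality of the squares says \<open>R ** D + D ** S = 0\<close>. Multiplying by \<open>D\<close>
  and taking the trace yields a sum, over the rows of \<open>D\<close>, of values of the positive definite
  form \<open>R + S\<close>; as the sum is zero, so is every row.
\<close>

lemma sym_pos_def_sqrt_unique:
  fixes R S :: "real ^ 'n ^ 'n"
  assumes R: "sym_pos_def R" and S: "sym_pos_def S" and eq: "R ** R = S ** S"
  shows "R = S"
proof -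
  define D where "D = R - S"
  have tD: "transpose D = D"
    using R S unfolding D_def sym_pos_def_def by (simp add: transpose_def vec_eq_iff)
  have diag: "(D ** C ** D) $ i $ i = D $ i \<bullet> (C *v D $ i)" for C i
  proof -
    have row: "D *v axis i 1 = D $ i"
      using tD by (metis matrix_vector_mult_basis row_def row_transpose vec_nth_inverse column_def)
    have "(D ** C ** D) $ i $ i = axis i 1 \<bullet> (D *v (C *v (D *v axis i 1)))"
      by (simp add: inner_axis' matrix_vector_mul_component inner_axis matrix_vector_mul_assoc matrix_mul_assoc)
    then show ?thesis
      by (simp add: inner_matrix_vector_transpose[of _ D] tD row)
  qed
  have "R ** D + D ** S = 0"
    unfolding D_def using eq
    by (simp add: matrix_eq matrix_vector_mult_add_rdistrib matrix_vector_mult_diff_rdistrib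
        matrix_vector_mult_diff_distrib flip: matrix_vector_mul_assoc)
  then have "trace (D ** (R ** D)) + trace (D ** (D ** S)) = 0"
    by (simp flip: trace_add matrix_add_ldistrib) (simp add: trace_def)
  moreover have "trace (D ** (D ** S)) = trace (D ** S ** D)"
    by (metis trace_mul_sym)
  ultimately have "trace (D ** R ** D) + trace (D ** S ** D) = 0"
    by (simp add: matrix_mul_assoc)
  then have "(\<Sum>i\<in>UNIV. D $ i \<bullet> (R *v D $ i) + D $ i \<bullet> (S *v D $ i)) = 0"
    by (simp add: trace_def diag sum.distrib)
  moreover have pos: "0 < x \<bullet> (R *v x) + x \<bullet> (S *v x)" if "x \<noteq> 0" for x
    using R S that unfolding sym_pos_def_def by (simp add: add_pos_pos)
  then have "0 \<le> x \<bullet> (R *v x) + x \<bullet> (S *v x)" for x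
    by (cases "x = 0") (auto intro: less_imp_le)
  ultimately have "D $ i \<bullet> (R *v D $ i) + D $ i \<bullet> (S *v D $ i) = 0" for i
    by (subst (asm) sum_nonneg_eq_0_iff) auto
  then have "D $ i = 0" for i
    using pos by (metis less_irrefl)
  then show ?thesis
    by (simp add: D_def vec_eq_iff)
qed

lemma matrix_sqrt_sym_pos_def:
  fixes A :: "real ^ 'n ^ 'n"
  assumes "invertible (A ** transpose A)"
  shows "sym_pos_def (matrix_sqrt (A ** transpose A))"
    and "matrix_sqrt (A ** transpose A) ** matrix_sqrt (A ** transpose A) = A ** transpose A"
proof -
  have "\<exists>!R. sym_pos_def R \<and> R ** R = A ** transpose A"
    using sym_pos_def_sqrt_exists[OF assms] sym_pos_def_sqrt_unique by metis
  from theI'[OF this]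
  show "sym_pos_def (matrix_sqrt (A ** transpose A))"
    and "matrix_sqrt (A ** transpose A) ** matrix_sqrt (A ** transpose A) = A ** transpose A"
    unfolding matrix_sqrt_def by auto
qed

lemma norm_matrix_sqrt_mult_vec:
  fixes A :: "real ^ 'n ^ 'n"
  assumes "invertible (A ** transpose A)"
  shows "norm (matrix_sqrt (A ** transpose A) *v v) = norm (transpose A *v v)"
proof -
  let ?R = "matrix_sqrt (A ** transpose A)"
  have "transpose ?R = ?R"
    using matrix_sqrt_sym_pos_def(1)[OF assms] by (simp add: sym_pos_def_def)
  then have "(?R *v v) \<bullet> (?R *v v) = v \<bullet> ((?R ** ?R) *v v)"
    by (metis inner_matrix_vector_transpose matrix_vector_mul_assoc)
  also have "\<dots> = v \<bullet> ((A ** transpose A) *v v)"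
    by (simp only: matrix_sqrt_sym_pos_def(2)[OF assms])
  also have "\<dots> = (transpose A *v v) \<bullet> (transpose A *v v)"
    by (simp add: inner_matrix_vector_transpose flip: matrix_vector_mul_assoc)
  finally show ?thesis
    by (simp add: norm_eq_sqrt_inner)
qed

section \<open>Mean and covariance of normal vectors\<close>

lemma prob_space_std_normal: "prob_space std_normal"
  unfolding std_normal_def by (rule prob_space_normal_density) simp

lemma sets_std_normal [measurable_cong, simp]: "sets std_normal = sets borel"
  by (simp add: std_normal_def)

lemma space_std_normal [simp]: "space std_normal = UNIV"
  by (simp add: std_normal_def)

lemma integrable_std_normal_power: "integrable std_normal (\<lambda>x. x ^ k)"
  unfolding std_normal_def
  by (subst integrable_density) (auto simp: integrable_std_normal_moment)

lemma integral_std_normal_power: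
  "(\<integral>x. x ^ k \<partial>std_normal) = (\<integral>x. std_normal_density x * x ^ k \<partial>lborel)"
  unfolding std_normal_def by (subst integral_density) auto

lemma integral_std_normal_id: "(\<integral>x. x \<partial>std_normal) = 0"
  using integral_std_normal_power[of 1] integral_std_normal_moment_odd[of 0] by simp

lemma integral_std_normal_square: "(\<integral>x. x\<^sup>2 \<partial>std_normal) = 1"
  using integral_std_normal_power[of 2] integral_std_normal_moment_even[of 1] by (simp add: fact_2)

lemma prob_space_std_normal_PiM: "prob_space (\<Pi>\<^sub>M i\<in>I. std_normal)"
  by (intro prob_space_PiM prob_space_std_normal)

lemma measurable_vec_lambda [measurable]:
  "(\<lambda>z. \<chi> i. z i) \<in> borel_measurable (\<Pi>\<^sub>M i\<in>(UNIV::'n::finite set). std_normal)"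
proof (subst borel_measurable_euclidean_space, intro ballI)
  fix b :: "real ^ 'n" assume "b \<in> Basis"
  then obtain i where b: "b = axis i 1"
    by (auto simp: Basis_vec_def)
  have "(\<lambda>z. z i) \<in> borel_measurable (\<Pi>\<^sub>M i\<in>(UNIV::'n set). std_normal)"
    by measurable
  then show "(\<lambda>z. (\<chi> i. z i) \<bullet> b) \<in> borel_measurable (\<Pi>\<^sub>M i\<in>(UNIV::'n set). std_normal)"
    by (simp add: b inner_axis)
qed

lemma sets_std_normal_vec [measurable_cong, simp]: "sets std_normal_vec = sets borel"
  by (simp add: std_normal_vec_def)

lemma space_std_normal_vec [simp]: "space std_normal_vec = UNIV"
  by (simp add: std_normal_vec_def)

lemma prob_space_std_normal_vec: "prob_space std_normal_vec"
  unfolding std_normal_vec_def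
  by (intro prob_space.prob_space_distr prob_space_std_normal_PiM measurable_vec_lambda)

text \<open>
  Coordinates and their products are products over all indices of functions of one coordinate,
  most of them constantly 1, so Fubini reduces their integrals to one-dimensional moments.
\<close>

lemma std_normal_vec_moments:
  fixes i j :: "'n::finite"
  shows "integrable std_normal_vec (\<lambda>z. z $ i)" "(\<integral>z. z $ i \<partial>std_normal_vec) = 0"
    and "integrable std_normal_vec (\<lambda>z. z $ i * z $ j)"
    and "(\<integral>z. z $ i * z $ j \<partial>std_normal_vec) = (if i = j then 1 else 0)"
proof -
  interpret product_prob_space "\<lambda>_::'n. std_normal" UNIV
    by (simp add: product_prob_space_def product_prob_space_axioms_def product_sigma_finite_def
        prob_space_std_normal prob_space_imp_sigma_finite)
  let ?P = "\<Pi>\<^sub>M i\<in>(UNIV::'n set). std_normal"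
  define m :: "'n \<Rightarrow> nat \<Rightarrow> 'n \<Rightarrow> real \<Rightarrow> real"
    where "m = (\<lambda>i k l x. if l = i then x ^ k else 1)"
  have prod_m: "(\<Prod>l\<in>UNIV. m i k l (z l)) = z i ^ k" for i k and z :: "'n \<Rightarrow> real"
    by (simp add: m_def)
  have int_m: "integrable std_normal (m i k l)" for i k l
    using integrable_std_normal_power[of k] integrable_std_normal_power[of 0]
    by (cases "l = i") (simp_all add: m_def)
  have one: "measure std_normal UNIV = 1"
    using prob_space.prob_space[OF prob_space_std_normal] by simp
  have coord: "integrable ?P (\<lambda>z. z i ^ k)" "(\<integral>z. z i ^ k \<partial>?P) = (\<integral>x. x ^ k \<partial>std_normal)" for i k
  proof -
    show "integrable ?P (\<lambda>z. z i ^ k)"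
      using product_integrable_prod[of UNIV "m i k"] int_m by (simp add: prod_m)
    have "(\<integral>z. z i ^ k \<partial>?P) = (\<Prod>l\<in>UNIV. integral\<^sup>L std_normal (m i k l))"
      using product_integral_prod[of UNIV "m i k"] int_m by (simp add: prod_m)
    also have "\<dots> = (\<Prod>l\<in>UNIV. if l = i then \<integral>x. x ^ k \<partial>std_normal else 1)"
      by (intro prod.cong) (auto simp: m_def one)
    finally show "(\<integral>z. z i ^ k \<partial>?P) = (\<integral>x. x ^ k \<partial>std_normal)"
      by simp
  qed
  have cross: "integrable ?P (\<lambda>z. z i * z j)" "(\<integral>z. z i * z j \<partial>?P) = 0" if "i \<noteq> j" for i j
  proof -
    \<comment> \<open>The factors at \<open>i\<close> and \<open>j\<close> are the identity, and that at \<open>i\<close> already integrates to 0.\<close>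
    define f where "f = (\<lambda>l x. m i 1 l x * m j 1 l x)"
    have prod_f: "(\<Prod>l\<in>UNIV. f l (z l)) = z i * z j" for z :: "'n \<Rightarrow> real"
      unfolding f_def prod.distrib prod_m by simp
    have int_f: "integrable std_normal (f l)" for l
      using int_m[of i 1 l] int_m[of j 1 l] that by (cases "l = i") (auto simp: m_def f_def)
    show "integrable ?P (\<lambda>z. z i * z j)"
      using product_integrable_prod[of UNIV f] int_f by (simp add: prod_f)
    have "(\<integral>z. z i * z j \<partial>?P) = (\<Prod>l\<in>UNIV. integral\<^sup>L std_normal (f l))"
      using product_integral_prod[of UNIV f] int_f by (simp add: prod_f)
    also have "integral\<^sup>L std_normal (f i) = 0"
      using that by (simp add: f_def m_def integral_std_normal_id)
    then have "(\<Prod>l\<in>UNIV. integral\<^sup>L std_normal (f l)) = 0"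
      by (intro prod_zero) auto
    finally show "(\<integral>z. z i * z j \<partial>?P) = 0" .
  qed
  note m = measurable_vec_lambda[where 'n='n]
  show "integrable std_normal_vec (\<lambda>z. z $ i)" "(\<integral>z. z $ i \<partial>std_normal_vec) = 0"
    using coord[of i 1] integral_std_normal_id
    unfolding std_normal_vec_def by (simp_all add: integrable_distr_eq integral_distr m)
  show "integrable std_normal_vec (\<lambda>z. z $ i * z $ j)"
    "(\<integral>z. z $ i * z $ j \<partial>std_normal_vec) = (if i = j then 1 else 0)"
    using coord[of i 2] integral_std_normal_square cross[of i j]
    unfolding std_normal_vec_def
    by (cases "i = j"; simp add: integrable_distr_eq integral_distr m power2_eq_square)+
qed

lemma measurable_affine [measurable]:
  "(\<lambda>z. \<mu> + A *v z) \<in> borel_measurable borel" for A :: "real ^ 'n ^ 'n"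
  by (intro borel_measurable_continuous_onI continuous_intros)

text \<open>
  Mean and covariance depend only on the law, so they may be computed for \<open>\<mu> + A *v z\<close>.
\<close>

lemma normal_vector_mean_and_covariance:
  fixes A :: "real ^ 'n ^ 'n"
  assumes X: "X \<in> borel_measurable M"
    and law: "distr M borel X = distr std_normal_vec borel (\<lambda>z. \<mu> + A *v z)"
  shows "mean_vector M X = \<mu>" and "covariance_matrix M X = A ** transpose A"
proof -
  interpret Z: prob_space "std_normal_vec :: (real ^ 'n) measure"
    by (rule prob_space_std_normal_vec)
  have meas: "(\<lambda>z. \<mu> + A *v z) \<in> measurable std_normal_vec borel"
    by measurable
  have transfer: "(\<integral>\<omega>. g (X \<omega>) \<partial>M) = (\<integral>z. g (\<mu> + A *v z) \<partial>std_normal_vec)"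
    if "g \<in> borel_measurable borel" for g :: "real ^ 'n \<Rightarrow> real"
    using integral_distr[OF X that] integral_distr[OF meas that] law by simp
  have "mean_vector M X $ i = \<mu> $ i" for i
  proof -
    have "mean_vector M X $ i = (\<integral>z. \<mu> $ i + (\<Sum>k\<in>UNIV. A $ i $ k * z $ k) \<partial>std_normal_vec)"
      using transfer[of "\<lambda>x. x $ i"] by (simp add: mean_vector_def matrix_vector_mult_def)
    also have "\<dots> = \<mu> $ i"
      by (simp add: std_normal_vec_moments Bochner_Integration.integral_sum Z.prob_space[simplified])
    finally show ?thesis .
  qed
  then show mean: "mean_vector M X = \<mu>"
    by (simp add: vec_eq_iff)
  have "covariance_matrix M X $ i $ j = (A ** transpose A) $ i $ j" for i j
  proof -
    have "covariance_matrix M X $ i $ j = (\<integral>z. (A *v z) $ i * (A *v z) $ j \<partial>std_normal_vec)"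
      using transfer[of "\<lambda>x. (x $ i - \<mu> $ i) * (x $ j - \<mu> $ j)"]
      by (simp add: covariance_matrix_def mean)
    also have "\<dots> = (\<integral>z. (\<Sum>k\<in>UNIV. \<Sum>l\<in>UNIV. A $ i $ k * A $ j $ l * (z $ k * z $ l)) \<partial>std_normal_vec)"
      by (simp add: matrix_vector_mult_def sum_product mult_ac)
    also have "\<dots> = (\<Sum>k\<in>UNIV. \<Sum>l\<in>UNIV. A $ i $ k * A $ j $ l * (if k = l then 1 else 0))"
      by (simp add: std_normal_vec_moments Bochner_Integration.integral_sum
          del: mult_cancel_left1 if_distrib)
    also have "\<dots> = (A ** transpose A) $ i $ j"
      by (simp add: matrix_matrix_mult_def transpose_def if_distrib cong: if_cong)
    finally show ?thesis .
  qed
  then show "covariance_matrix M X = A ** transpose A"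
    by (simp add: vec_eq_iff)
qed

section \<open>The chi-squared quantile\<close>

text \<open>
  The chi-squared law is built from coordinates indexed by an initial segment of the naturals,
  the vector from coordinates indexed by a finite type. A bijection between the index sets
  carries one product measure to the other and preserves the sum of squares.
\<close>

lemma distr_std_normal_vec_norm_square:
  "distr std_normal_vec borel (\<lambda>z :: real ^ 'n::finite. z \<bullet> z) = chi_squared CARD('n)"
proof -
  obtain h where h: "bij_betw h {..<CARD('n)} (UNIV :: 'n set)"
    using ex_bij_betw_nat_finite[of "UNIV :: 'n set"] by (auto simp: atLeast0LessThan)
  let ?N = "{..<CARD('n)}"
  let ?P = "\<Pi>\<^sub>M i\<in>(UNIV::'n set). std_normal"
  have re: "distr ?P (\<Pi>\<^sub>M i\<in>?N. std_normal) (\<lambda>\<omega>. \<lambda>n\<in>?N. \<omega> (h n)) = (\<Pi>\<^sub>M i\<in>?N. std_normal)"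
    using distr_PiM_reindex[of UNIV "\<lambda>_. std_normal" h ?N] h prob_space_std_normal
    by (auto simp: bij_betw_def)
  have sq: "(\<Sum>i<CARD('n). (z (h i))\<^sup>2) = (\<chi> i. z i) \<bullet> (\<chi> i. z i)" for z :: "'n \<Rightarrow> real"
    using sum.reindex_bij_betw[OF h, of "\<lambda>i. (z i)\<^sup>2"] by (simp add: inner_vec_def power2_eq_square)
  have "chi_squared CARD('n) = distr (distr ?P (\<Pi>\<^sub>M i\<in>?N. std_normal) (\<lambda>\<omega>. \<lambda>n\<in>?N. \<omega> (h n)))
      borel (\<lambda>z. \<Sum>i<CARD('n). (z i)\<^sup>2)"
    by (simp add: chi_squared_def re)
  also have "\<dots> = distr ?P borel ((\<lambda>z. \<Sum>i<CARD('n). (z i)\<^sup>2) \<circ> (\<lambda>\<omega>. \<lambda>n\<in>?N. \<omega> (h n)))"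
    by (intro distr_distr) measurable
  also have "(\<lambda>z. \<Sum>i<CARD('n). (z i)\<^sup>2) \<circ> (\<lambda>\<omega>. \<lambda>n\<in>?N. \<omega> (h n)) = (\<lambda>z. z \<bullet> z) \<circ> (\<lambda>z :: 'n \<Rightarrow> real. \<chi> i. z i)"
    by (simp add: fun_eq_iff flip: sq)
  also have "distr ?P borel \<dots> = distr std_normal_vec borel (\<lambda>z :: real ^ 'n. z \<bullet> z)"
    unfolding std_normal_vec_def by (rule distr_distr[symmetric]) (simp_all add: measurable_vec_lambda)
  finally show ?thesis ..
qed

text \<open>
  Every point to the right of the infimum exceeds a member of the set whose infimum is taken,
  which is nonempty because the distribution function tends to 1. Monotonicity gives the bound
  at all these points, and right continuity carries it to the infimum itself.
\<close>

lemma (in real_distribution) cdf_quantile_ge: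
  assumes "u < 1"
  shows "u \<le> cdf M (quantile M u)"
proof -
  let ?S = "{x. u \<le> cdf M x}"
  have "eventually (\<lambda>x. u < cdf M x) at_top"
    using cdf_lim_at_top_prob assms by (rule order_tendstoD)
  then obtain a where "u < cdf M a"
    by (auto simp: eventually_at_top_linorder)
  then have ne: "?S \<noteq> {}"
    by (auto intro: less_imp_le)
  have above: "u \<le> cdf M x" if x: "quantile M u < x" for x
  proof -
    obtain y where "y \<in> ?S" "y < x"
      using cInf_lessD[OF ne, of x] x by (auto simp: quantile_def)
    then show ?thesis
      using cdf_nondecreasing[of y x] by simp
  qed
  have "(cdf M \<longlongrightarrow> cdf M (quantile M u)) (at_right (quantile M u))"
    using cdf_is_right_cont[of "quantile M u"] by (simp add: continuous_within)
  then show ?thesis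
    by (rule tendsto_lowerbound)
      (auto simp: eventually_at_right_field intro!: exI[of _ "quantile M u + 1"] above)
qed

section \<open>Coverage of the uncertainty set\<close>

lemma closed_uncertainty_set: "closed (uncertainty_set E \<gamma>)"
proof -
  have "uncertainty_set E \<gamma> = (\<Inter>i. {\<delta>. \<bar>\<delta> $ i\<bar> \<le> \<gamma> i i}) \<inter>
      (\<Inter>(i, j)\<in>{(i, j). {i, j} \<in> E}. {\<delta>. \<bar>\<delta> $ i - \<delta> $ j\<bar> \<le> \<gamma> i j})"
    by (auto simp: uncertainty_set_def)
  then show ?thesis
    by (auto intro!: closed_Int closed_INT closed_Collect_le continuous_intros)
qed

theorem proposition7:
  fixes M :: "'a measure"
    and X :: "'a \<Rightarrow> real ^ 'n::finite"
    and \<Sigma> :: "real ^ 'n ^ 'n"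
    and E :: "'n set set"
    and p :: real
    and \<gamma> :: "'n \<Rightarrow> 'n \<Rightarrow> real"
  assumes "prob_space M"
    and "normal_vector M X"
    and "mean_vector M X = 0"
    and "covariance_matrix M X = \<Sigma>"
    and "invertible \<Sigma>"
    and "\<And>i. \<Sigma> $ i $ i = 1"
    and "\<And>e. e \<in> E \<Longrightarrow> card e = 2"
    and "0 < p" and "p < 1"
    and "\<And>i j. {i, j} \<in> E \<or> i = j \<Longrightarrow>
           \<gamma> i j = sqrt (quantile (chi_squared CARD('n)) (1 - p)) * norm (matrix_sqrt \<Sigma> *v diff_vec i j)"
  shows "measure M {\<omega> \<in> space M. X \<omega> \<in> uncertainty_set E \<gamma>} \<ge> 1 - p"
proof -
  let ?S = "matrix_sqrt \<Sigma>"
  let ?N = "std_normal_vec :: (real ^ 'n) measure"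
  let ?U = "uncertainty_set E \<gamma>"
  define q where "q = quantile (chi_squared CARD('n)) (1 - p)"
  obtain \<mu> A where X: "X \<in> borel_measurable M"
    and law: "distr M borel X = distr ?N borel (\<lambda>z. \<mu> + A *v z)"
    using \<open>normal_vector M X\<close> unfolding normal_vector_def by blast
  have "\<mu> = 0" and \<Sigma>: "\<Sigma> = A ** transpose A"
    using normal_vector_mean_and_covariance[OF X law] assms(3,4) by simp_all
  \<comment> \<open>The ellipsoid, the image of the ball under \<open>A\<close>, has half-width \<open>sqrt q * norm (?S *v v)\<close>
     in direction \<open>v\<close>.\<close>
  have width: "\<bar>v \<bullet> (A *v z)\<bar> \<le> sqrt q * norm (?S *v v)" if z: "z \<bullet> z \<le> q" for v z
  proof -
    have "\<bar>v \<bullet> (A *v z)\<bar> \<le> norm (transpose A *v v) * norm z"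
      by (metis inner_matrix_vector_transpose Cauchy_Schwarz_ineq2)
    also have "\<dots> \<le> norm (transpose A *v v) * sqrt q"
      using z by (intro mult_left_mono) (simp_all add: norm_eq_sqrt_inner)
    also have "norm (transpose A *v v) = norm (?S *v v)"
      using norm_matrix_sqrt_mult_vec[of A v] \<open>invertible \<Sigma>\<close> by (simp add: \<Sigma>)
    finally show ?thesis
      by (simp add: mult.commute)
  qed
  have ball: "A *v z \<in> ?U" if z: "z \<bullet> z \<le> q" for z
    unfolding uncertainty_set_def
  proof (intro CollectI conjI allI impI)
    fix i
    show "\<bar>(A *v z) $ i\<bar> \<le> \<gamma> i i"
      using width[OF z, of "diff_vec i i"] assms(10)[of i i]
      by (simp add: diff_vec_def q_def inner_axis')
  next
    fix i j assume E: "{i, j} \<in> E"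
    \<comment> \<open>On a loop, \<open>diff_vec\<close> would be a unit vector and not the difference of two.\<close>
    with assms(7)[OF this] have "i \<noteq> j"
      by auto
    then show "\<bar>(A *v z) $ i - (A *v z) $ j\<bar> \<le> \<gamma> i j"
      using width[OF z, of "diff_vec i j"] assms(10)[of i j] E
      by (simp add: diff_vec_def q_def inner_axis' inner_diff_left)
  qed
  interpret N: prob_space ?N
    by (rule prob_space_std_normal_vec)
  have sqn: "(\<lambda>z. z \<bullet> z) \<in> borel_measurable ?N"
    by simp
  interpret chi: real_distribution "chi_squared CARD('n)"
    unfolding distr_std_normal_vec_norm_square[symmetric]
    using sqn by (rule N.real_distribution_distr)
  have U: "?U \<in> sets borel"
    by (intro borel_closed closed_uncertainty_set)
  have A: "(\<lambda>z. A *v z) \<in> measurable ?N borel"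
    using measurable_affine[of 0 A] by simp
  have "1 - p \<le> cdf (chi_squared CARD('n)) q"
    unfolding q_def using \<open>0 < p\<close> by (intro chi.cdf_quantile_ge) simp
  also have "\<dots> = measure ?N {z. z \<bullet> z \<le> q}"
    unfolding cdf_def distr_std_normal_vec_norm_square[symmetric]
    by (subst measure_distr[OF sqn]) (simp_all add: vimage_def space_std_normal_vec)
  also have "\<dots> \<le> measure ?N ((\<lambda>z. A *v z) -` ?U \<inter> space ?N)"
    using ball measurable_sets[OF A U] by (intro N.finite_measure_mono) (auto simp: space_std_normal_vec)
  also have "\<dots> = measure (distr M borel X) ?U"
    using measure_distr[OF A U] law \<open>\<mu> = 0\<close> by simp
  also have "\<dots> = measure M {\<omega> \<in> space M. X \<omega> \<in> ?U}"
    using measure_distr[OF X U] by (simp add: vimage_def Int_def conj_commute)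
  finally show ?thesis .
qed

end
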